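(* Assume the abstract energy hypothesis (EH) stated in the context, with constants $c_E,C_E>0$ independent of $h$, $\tau$ and of the horizon $m$. Let $(R^n)_{n_0\le n\le N}\subset\mathcal H$ and let $(V^n)_{0\le n\le N}\subset\mathcal V_h$ satisfy $$(A_\tau V^n,T_\delta W)_\Omega=(R^n,T_\delta W)_\Omega\qquad\forall W\in\mathcal V_h,\ n_0\le n\le N.$$ Then $$\|V\|_{\mathcal E,N}^2\ \le\ C\Bigl(\mathcal I_\tau(V)+\|R\|_{\mathcal E^*,N}^2+\tau\|R\|_{\ell_\tau^2(n_0,N;\mathcal H)}^2\Bigr),$$ where $C$ is independent of $h$ and $\tau$ (and of $N$, $V$, $R$).
   Context: Setting. $\mathcal H$ is a real Hilbert space with inner product $(\cdot,\cdot)_\Omega$ and norm $\|\cdot\|_\Omega$; $\mathcal V\subset\mathcal H$ is a dense subspace; $G:\mathcal V\to\mathcal H$ is linear, time independent and skew-symmetric: $(GU,V)_\Omega=-(U,GV)_\Omega$ for all $U,V\in\mathcal V$. $\mathcal V_h\subset\mathcal V$ is a finite-dimensional (conforming finite element) subspace with mesh size $h>0$. $\tau>0$ is the time step, $t^n=n\tau$ for $0\le n\le N$, $t^N\le T$; $\delta>0$ is the stabilisation parameter. For a sequence $(V^n)$ and fixed real coefficients $b_0,\dots,b_\ell$, $$D_\tau^-V^n=\tau^{-1}(V^n-V^{n-1}),\qquad \mathcal M_\tau V^n=\sum_{j=0}^{\ell}b_jV^{n-j}.$$ The first computed index is $n_0$, with $n_0\ge\ell$, $1\le n_0\le N$; the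 values at levels $0,\dots,n_0-1$ are prescribed start-up data. Operators: $$T_\delta=\mathrm{Id}+\delta G,\quad S_\delta=\mathcal M_\tau+\delta D_\tau^-,\quad A_\tau=D_\tau^-+G\mathcal M_\tau,\quad P_\delta=T_\delta S_\delta .$$ Sequence norms. For each $n_0\le n\le N$, $e_\tau^n(V)\ge0$ (energy) and $d_\tau^n(V)\ge0$ (dissipation) are given method-dependent quantities, depending only on the values $V^j$, $0\le j\le n$, of the sequence. For $n_0\le m\le N$, $$\|V\|_{\mathcal E,m}^2=\max_{n_0\le j\le m}e_\tau^j(V)+\tau\sum_{n=n_0}^m d_\tau^n(V),\qquad \mathcal I_\tau(V)=\sum_{j=0}^{n_0-1}\|T_\delta V^j\|_\Omega^2,$$ $$\|R\|_{\ell_\tau^2(n_0,m;\mathcal H)}^2=\tau\sum_{n=n_0}^m\|R^n\|_\Omega^2,$$ and the lifted dual norm is $$\|R\|_{\mathcal E^*,N}=\max_{n_0\le m\le N}\ \sup_{V}\ \frac{\tau\sum_{n=n_0}^m(R^n,P_\delta V^n)_\Omega}{\bigl(\mathcal I_\tau(V)+\|V\|_{\mathcal E,m}^2\bigr)^{1/2}},$$ where the supremum is over $\mathcal V_h$-valued sequences with $V^n=0$ for $n\notin\{0,\dots,m\}$ and $\mathcal I_\tau(V)+\|V\|_{\mathcal E,m}^2>0$. Energy hypothesis (EH). There are $c_E,C_E>0$, independent of $h,\tau,m$, such that for all $\mathcal V_h$-valued sequences $V$ and all $n_0\le m,n\le N$, $$c_E\|T_\delta V^m\|_\Omega^2\le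 e_\tau^m(V),\qquad c_E\,\delta\|A_\tau V^n\|_\Omega^2\le d_\tau^n(V),$$ and every solution $V$ (with values in $\mathcal V_h$) of $(A_\tau V^n,T_\delta W)_\Omega=(R^n,T_\delta W)_\Omega$ for all $W\in\mathcal V_h$ satisfies, for every $n_0\le m\le N$, $$e_\tau^m(V)+\tau\sum_{n=n_0}^m d_\tau^n(V)\le C_E\mathcal I_\tau(V)+C_E\tau\sum_{n=n_0}^m(R^n,P_\delta V^n)_\Omega+C_E\tau\|R\|_{\ell_\tau^2(n_0,m;\mathcal H)}^2 .$$ *)

theory Defs
  imports "HOL-Analysis.Analysis"
begin

(* G is an unbounded operator with domain Vs; as a HOL function it is total,
   and its values outside Vs carry no meaning. *)
definition skew_operator :: "'a::real_inner set \<Rightarrow> ('a \<Rightarrow> 'a) \<Rightarrow> bool" where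
  "skew_operator Vs G \<longleftrightarrow>
     (\<forall>U\<in>Vs. \<forall>V\<in>Vs. G (U + V) = G U + G V) \<and>
     (\<forall>c. \<forall>U\<in>Vs. G (c *\<^sub>R U) = c *\<^sub>R G U) \<and>
     (\<forall>U\<in>Vs. \<forall>V\<in>Vs. G U \<bullet> V = - (U \<bullet> G V))"

definition finite_dim_subspace :: "'a::real_vector set \<Rightarrow> bool" where
  "finite_dim_subspace U \<longleftrightarrow> subspace U \<and> (\<exists>B. finite B \<and> U = span B)"

(* Sequences are functions on nat. The operators below are only evaluated at time levels
   n with n >= n0 >= max 1 l, so the natural-number subtractions n - 1 and n - j (j <= l)
   never truncate. *)

definition Tstab :: "('a::real_vector \<Rightarrow> 'a) \<Rightarrow> real \<Rightarrow> 'a \<Rightarrow> 'a" where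
  "Tstab G \<delta> U = U + \<delta> *\<^sub>R G U"

definition Dminus :: "real \<Rightarrow> (nat \<Rightarrow> 'a::real_vector) \<Rightarrow> nat \<Rightarrow> 'a" where
  "Dminus \<tau> V n = inverse \<tau> *\<^sub>R (V n - V (n - 1))"

definition Mavg :: "(nat \<Rightarrow> real) \<Rightarrow> nat \<Rightarrow> (nat \<Rightarrow> 'a::real_vector) \<Rightarrow> nat \<Rightarrow> 'a" where
  "Mavg b l V n = (\<Sum>j=0..l. b j *\<^sub>R V (n - j))"

definition Sstab ::
  "(nat \<Rightarrow> real) \<Rightarrow> nat \<Rightarrow> real \<Rightarrow> real \<Rightarrow> (nat \<Rightarrow> 'a::real_vector) \<Rightarrow> nat \<Rightarrow> 'a" where
  "Sstab b l \<tau> \<delta> V n = Mavg b l V n + \<delta> *\<^sub>R Dminus \<tau> V n"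

definition Aop ::
  "('a::real_vector \<Rightarrow> 'a) \<Rightarrow> (nat \<Rightarrow> real) \<Rightarrow> nat \<Rightarrow> real \<Rightarrow> (nat \<Rightarrow> 'a) \<Rightarrow> nat \<Rightarrow> 'a" where
  "Aop G b l \<tau> V n = Dminus \<tau> V n + G (Mavg b l V n)"

definition Pop ::
  "('a::real_vector \<Rightarrow> 'a) \<Rightarrow> (nat \<Rightarrow> real) \<Rightarrow> nat \<Rightarrow> real \<Rightarrow> real \<Rightarrow> (nat \<Rightarrow> 'a) \<Rightarrow> nat \<Rightarrow> 'a" where
  "Pop G b l \<tau> \<delta> V n = Tstab G \<delta> (Sstab b l \<tau> \<delta> V n)"

(* Only the levels 0..N matter; the values beyond N are unconstrained. *)
definition seqs :: "'a set \<Rightarrow> nat \<Rightarrow> (nat \<Rightarrow> 'a) set" where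
  "seqs Vh N = {V. \<forall>n\<le>N. V n \<in> Vh}"

definition discrete_solution ::
  "('a::real_inner \<Rightarrow> 'a) \<Rightarrow> (nat \<Rightarrow> real) \<Rightarrow> nat \<Rightarrow> nat \<Rightarrow> real \<Rightarrow> real \<Rightarrow> 'a set \<Rightarrow> nat \<Rightarrow>
   (nat \<Rightarrow> 'a) \<Rightarrow> (nat \<Rightarrow> 'a) \<Rightarrow> bool" where
  "discrete_solution G b l n0 \<tau> \<delta> Vh N R V \<longleftrightarrow>
     V \<in> seqs Vh N \<and>
     (\<forall>n\<in>{n0..N}. \<forall>W\<in>Vh. Aop G b l \<tau> V n \<bullet> Tstab G \<delta> W = R n \<bullet> Tstab G \<delta> W)"

(* The requirements on each of the given families e (energy) and d (dissipation):
   nonnegative, and q n V depends only on V 0, ..., V n. *)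
definition causal_nonneg ::
  "'a set \<Rightarrow> nat \<Rightarrow> nat \<Rightarrow> (nat \<Rightarrow> (nat \<Rightarrow> 'a) \<Rightarrow> real) \<Rightarrow> bool" where
  "causal_nonneg Vh n0 N q \<longleftrightarrow>
     (\<forall>n\<in>{n0..N}. \<forall>V\<in>seqs Vh N. 0 \<le> q n V) \<and>
     (\<forall>n\<in>{n0..N}. \<forall>V\<in>seqs Vh N. \<forall>W\<in>seqs Vh N. (\<forall>j\<le>n. V j = W j) \<longrightarrow> q n V = q n W)"

definition energy_norm_sq ::
  "nat \<Rightarrow> real \<Rightarrow> (nat \<Rightarrow> (nat \<Rightarrow> 'a) \<Rightarrow> real) \<Rightarrow> (nat \<Rightarrow> (nat \<Rightarrow> 'a) \<Rightarrow> real) \<Rightarrow>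
   nat \<Rightarrow> (nat \<Rightarrow> 'a) \<Rightarrow> real" where
  "energy_norm_sq n0 \<tau> e d m V =
     Max ((\<lambda>j. e j V) ` {n0..m}) + \<tau> * (\<Sum>n=n0..m. d n V)"

definition startup ::
  "('a::real_inner \<Rightarrow> 'a) \<Rightarrow> nat \<Rightarrow> real \<Rightarrow> (nat \<Rightarrow> 'a) \<Rightarrow> real" where
  "startup G n0 \<delta> V = (\<Sum>j<n0. (norm (Tstab G \<delta> (V j)))\<^sup>2)"

definition l2_norm_sq :: "nat \<Rightarrow> real \<Rightarrow> nat \<Rightarrow> (nat \<Rightarrow> 'a::real_inner) \<Rightarrow> real" where
  "l2_norm_sq n0 \<tau> m R = \<tau> * (\<Sum>n=n0..m. (norm (R n))\<^sup>2)"

definition dual_quotients ::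
  "('a::real_inner \<Rightarrow> 'a) \<Rightarrow> (nat \<Rightarrow> real) \<Rightarrow> nat \<Rightarrow> nat \<Rightarrow> real \<Rightarrow> real \<Rightarrow> 'a set \<Rightarrow> nat \<Rightarrow>
   (nat \<Rightarrow> (nat \<Rightarrow> 'a) \<Rightarrow> real) \<Rightarrow> (nat \<Rightarrow> (nat \<Rightarrow> 'a) \<Rightarrow> real) \<Rightarrow>
   (nat \<Rightarrow> 'a) \<Rightarrow> nat \<Rightarrow> real set" where
  "dual_quotients G b l n0 \<tau> \<delta> Vh N e d R m =
     {\<tau> * (\<Sum>n=n0..m. R n \<bullet> Pop G b l \<tau> \<delta> V n)
        / sqrt (startup G n0 \<delta> V + energy_norm_sq n0 \<tau> e d m V) | V.
      V \<in> seqs Vh N \<and> (\<forall>n. n \<notin> {0..m} \<longrightarrow> V n = 0) \<and>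
      startup G n0 \<delta> V + energy_norm_sq n0 \<tau> e d m V > 0}"

(* The supremum is taken in the extended reals, so no boundedness is presupposed.
   There may be no admissible test sequence (e.g. Vh = {0}); then the supremum counts as 0. *)
definition dual_norm ::
  "('a::real_inner \<Rightarrow> 'a) \<Rightarrow> (nat \<Rightarrow> real) \<Rightarrow> nat \<Rightarrow> nat \<Rightarrow> real \<Rightarrow> real \<Rightarrow> 'a set \<Rightarrow> nat \<Rightarrow>
   (nat \<Rightarrow> (nat \<Rightarrow> 'a) \<Rightarrow> real) \<Rightarrow> (nat \<Rightarrow> (nat \<Rightarrow> 'a) \<Rightarrow> real) \<Rightarrow>
   (nat \<Rightarrow> 'a) \<Rightarrow> ereal" where
  "dual_norm G b l n0 \<tau> \<delta> Vh N e d R =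
     Max ((\<lambda>m. let Q = dual_quotients G b l n0 \<tau> \<delta> Vh N e d R m
               in if Q = {} then 0 else (SUP q\<in>Q. ereal q)) ` {n0..N})"

definition energy_hypothesis ::
  "('a::real_inner \<Rightarrow> 'a) \<Rightarrow> (nat \<Rightarrow> real) \<Rightarrow> nat \<Rightarrow> nat \<Rightarrow> real \<Rightarrow> real \<Rightarrow> 'a set \<Rightarrow> nat \<Rightarrow>
   (nat \<Rightarrow> (nat \<Rightarrow> 'a) \<Rightarrow> real) \<Rightarrow> (nat \<Rightarrow> (nat \<Rightarrow> 'a) \<Rightarrow> real) \<Rightarrow>
   real \<Rightarrow> real \<Rightarrow> bool" where
  "energy_hypothesis G b l n0 \<tau> \<delta> Vh N e d cE CE \<longleftrightarrow>
     (\<forall>V\<in>seqs Vh N. \<forall>m\<in>{n0..N}. cE * (norm (Tstab G \<delta> (V m)))\<^sup>2 \<le> e m V) \<and>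
     (\<forall>V\<in>seqs Vh N. \<forall>n\<in>{n0..N}. cE * \<delta> * (norm (Aop G b l \<tau> V n))\<^sup>2 \<le> d n V) \<and>
     (\<forall>R V. discrete_solution G b l n0 \<tau> \<delta> Vh N R V \<longrightarrow>
        (\<forall>m\<in>{n0..N}.
           e m V + \<tau> * (\<Sum>n=n0..m. d n V)
           \<le> CE * startup G n0 \<delta> V
             + CE * \<tau> * (\<Sum>n=n0..m. R n \<bullet> Pop G b l \<tau> \<delta> V n)
             + CE * \<tau> * l2_norm_sq n0 \<tau> m R))"

end

theory Submission
  imports Defs
begin

text \<open>
  Write \<open>E\<^sub>m\<close> for the squared energy norm up to level \<open>m\<close>, \<open>I\<close> for the start-up quantity and
  \<open>D\<close> for the dual norm. The energy hypothesis bounds \<open>e m V\<close> plus the accumulated dissipation by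
  \<open>C\<^sub>E\<close> times the sum of \<open>I\<close>, a term quadratic in \<open>R\<close> and the pairing of \<open>R\<close> with \<open>P V\<close>
  over the levels up to \<open>m\<close>.
  Cutting \<open>V\<close> off after level \<open>m\<close> changes none of these quantities, since all of them look only
  backwards in time, and it produces an admissible test sequence for the dual norm. Hence the
  pairing is at most \<open>D sqrt (I + E\<^sub>m)\<close>: this is lemma \<open>pairing_le_dual_norm\<close>.

  The maximum in \<open>E\<^sub>N\<close> is attained at some horizon \<open>m\<close>, which need not be \<open>N\<close>; this is why the
  dual norm ranges over all horizons. Using the energy hypothesis once at that horizon, for the
  energy, and once at \<open>N\<close>, for the dissipation, gives
  \<open>E\<^sub>N \<le> 2 C\<^sub>E (I + \<bar>D\<bar> sqrt (I + E\<^sub>N) + L)\<close>, where \<open>L\<close> is the quadratic term up to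
  level \<open>N\<close>. By Young's inequality half of \<open>E\<^sub>N\<close> can be absorbed on the left
  (lemma \<open>absorb_sqrt\<close>), with a constant that depends on \<open>C\<^sub>E\<close> only.

  The one degenerate case of the duality bound is \<open>I + E\<^sub>m = 0\<close>, where the cut-off sequence is not
  admissible. There coercivity gives \<open>T\<^sub>\<delta> V\<^sup>j = 0\<close> for all \<open>j \<le> m\<close>, and \<open>T\<^sub>\<delta>\<close> is
  injective because \<open>G\<close> is skew-symmetric; so \<open>V\<close> vanishes up to level \<open>m\<close> and so does the
  pairing.
\<close>

section \<open>Injectivity of the stabilised test operator\<close>

text \<open>
  Skew-symmetry makes \<open>U\<close> and \<open>G U\<close> orthogonal, so this is the theorem of Pythagoras.
\<close>

lemma norm_Tstab_sq:
  assumes "skew_operator Vs G" and "U \<in> Vs"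
  shows "(norm (Tstab G \<delta> U))\<^sup>2 = (norm U)\<^sup>2 + \<delta>\<^sup>2 * (norm (G U))\<^sup>2"
proof -
  have "G U \<bullet> U = - (U \<bullet> G U)"
    using assms by (auto simp: skew_operator_def)
  then have "U \<bullet> G U = 0"
    by (simp add: inner_commute)
  then show ?thesis
    unfolding Tstab_def power2_norm_eq_inner
    by (simp add: inner_add_left inner_add_right inner_commute power2_eq_square)
qed

lemma Tstab_eq_0D:
  assumes "skew_operator Vs G" and "U \<in> Vs" and "Tstab G \<delta> U = 0"
  shows "U = 0"
proof -
  have "(norm U)\<^sup>2 + \<delta>\<^sup>2 * (norm (G U))\<^sup>2 = 0"
    using norm_Tstab_sq[OF assms(1,2), of \<delta>] assms(3) by simp
  moreover have "0 \<le> \<delta>\<^sup>2 * (norm (G U))\<^sup>2"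
    by simp
  ultimately have "(norm U)\<^sup>2 \<le> 0"
    by linarith
  then show ?thesis
    by simp
qed

lemma Tstab_zero:
  assumes "skew_operator Vs G" and "0 \<in> Vs"
  shows "Tstab G \<delta> 0 = 0"
proof -
  have "G (0 + 0) = G 0 + G 0"
    using assms unfolding skew_operator_def by blast
  then show ?thesis
    by (simp add: Tstab_def)
qed

section \<open>Causality and monotonicity in the horizon\<close>

lemma Pop_cong:
  assumes "\<And>j. j \<le> n \<Longrightarrow> V j = W j"
  shows "Pop G b l \<tau> \<delta> V n = Pop G b l \<tau> \<delta> W n"
  using assms by (simp add: Pop_def Sstab_def Mavg_def Dminus_def)

lemma startup_cong:
  assumes "\<And>j. j < n0 \<Longrightarrow> V j = W j"
  shows "startup G n0 \<delta> V = startup G n0 \<delta> W"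
  using assms by (simp add: startup_def)

lemma energy_norm_sq_cong:
  assumes "causal_nonneg Vh n0 N e" and "causal_nonneg Vh n0 N d"
    and "V \<in> seqs Vh N" and "W \<in> seqs Vh N" and "m \<le> N"
    and eq: "\<And>j. j \<le> m \<Longrightarrow> V j = W j"
  shows "energy_norm_sq n0 \<tau> e d m V = energy_norm_sq n0 \<tau> e d m W"
proof -
  have e: "e n V = e n W" and d: "d n V = d n W" if "n \<in> {n0..m}" for n
  proof -
    have n: "n \<in> {n0..N}" and j: "\<forall>j\<le>n. V j = W j"
      using that \<open>m \<le> N\<close> eq by auto
    show "e n V = e n W" "d n V = d n W"
      using assms(1-4) n j unfolding causal_nonneg_def by blast+
  qed
  have "(\<lambda>j. e j V) ` {n0..m} = (\<lambda>j. e j W) ` {n0..m}"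
    using e by (rule image_cong[OF refl])
  moreover have "(\<Sum>n=n0..m. d n V) = (\<Sum>n=n0..m. d n W)"
    using d by (rule sum.cong[OF refl])
  ultimately show ?thesis
    by (simp add: energy_norm_sq_def)
qed

lemma startup_nonneg: "0 \<le> startup G n0 \<delta> V"
  by (simp add: startup_def sum_nonneg)

lemma l2_norm_sq_nonneg: "0 \<le> \<tau> \<Longrightarrow> 0 \<le> l2_norm_sq n0 \<tau> m R"
  by (simp add: l2_norm_sq_def sum_nonneg)

lemma l2_norm_sq_mono:
  assumes "0 \<le> \<tau>" and "m \<le> N"
  shows "l2_norm_sq n0 \<tau> m R \<le> l2_norm_sq n0 \<tau> N R"
  unfolding l2_norm_sq_def
  using assms by (intro mult_left_mono sum_mono2) auto

lemma causal_nonnegD: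
  assumes "causal_nonneg Vh n0 N q" and "V \<in> seqs Vh N" and "n \<in> {n0..N}"
  shows "0 \<le> q n V"
  using assms unfolding causal_nonneg_def by blast

lemma dissipation_nonneg:
  assumes "causal_nonneg Vh n0 N d" and "V \<in> seqs Vh N" and "0 \<le> \<tau>" and "m \<le> N"
  shows "0 \<le> \<tau> * (\<Sum>n=n0..m. d n V)"
  using assms(3,4) by (intro mult_nonneg_nonneg sum_nonneg causal_nonnegD[OF assms(1,2)]) auto

lemma energy_le_energy_norm_sq:
  assumes "causal_nonneg Vh n0 N d" and "V \<in> seqs Vh N" and "0 \<le> \<tau>"
    and "m \<le> N" and "j \<in> {n0..m}"
  shows "e j V \<le> energy_norm_sq n0 \<tau> e d m V"
proof -
  have "e j V \<le> Max ((\<lambda>j. e j V) ` {n0..m})"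
    using assms(5) by (intro Max_ge) auto
  then show ?thesis
    using dissipation_nonneg[OF assms(1-4)] by (simp add: energy_norm_sq_def)
qed

lemma energy_norm_sq_nonneg:
  assumes "causal_nonneg Vh n0 N e" and "causal_nonneg Vh n0 N d" and "V \<in> seqs Vh N"
    and "0 \<le> \<tau>" and "n0 \<le> m" and "m \<le> N"
  shows "0 \<le> energy_norm_sq n0 \<tau> e d m V"
proof -
  have "0 \<le> e m V"
    using assms(5,6) by (intro causal_nonnegD[OF assms(1,3)]) auto
  also have "\<dots> \<le> energy_norm_sq n0 \<tau> e d m V"
    using assms by (intro energy_le_energy_norm_sq) auto
  finally show ?thesis .
qed

lemma energy_norm_sq_mono:
  assumes "causal_nonneg Vh n0 N d" and "V \<in> seqs Vh N" and "0 \<le> \<tau>"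
    and "n0 \<le> m" and "m \<le> N"
  shows "energy_norm_sq n0 \<tau> e d m V \<le> energy_norm_sq n0 \<tau> e d N V"
  unfolding energy_norm_sq_def
proof (rule add_mono)
  show "Max ((\<lambda>j. e j V) ` {n0..m}) \<le> Max ((\<lambda>j. e j V) ` {n0..N})"
    using assms(4,5) by (intro Max_mono) auto
  have "(\<Sum>n=n0..m. d n V) \<le> (\<Sum>n=n0..N. d n V)"
    using assms(5) by (intro sum_mono2 causal_nonnegD[OF assms(1,2)]) auto
  then show "\<tau> * (\<Sum>n=n0..m. d n V) \<le> \<tau> * (\<Sum>n=n0..N. d n V)"
    using assms(3) by (rule mult_left_mono)
qed

section \<open>Duality on truncated horizons\<close>

lemma dual_quotient_le_dual_norm:
  assumes "q \<in> dual_quotients G b l n0 \<tau> \<delta> Vh N e d R m" and "m \<in> {n0..N}"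
  shows "ereal q \<le> dual_norm G b l n0 \<tau> \<delta> Vh N e d R"
proof -
  let ?Q = "dual_quotients G b l n0 \<tau> \<delta> Vh N e d R"
  have "ereal q \<le> (SUP q\<in>?Q m. ereal q)"
    using assms(1) by (rule SUP_upper)
  also have "\<dots> = (let Q = ?Q m in if Q = {} then 0 else (SUP q\<in>Q. ereal q))"
    using assms(1) by (auto simp: Let_def)
  also have "\<dots> \<le> dual_norm G b l n0 \<tau> \<delta> Vh N e d R"
    unfolding dual_norm_def using assms(2) by (intro Max_ge) auto
  finally show ?thesis .
qed

text \<open>
  Coercivity of the energy controls the levels from \<open>n0\<close> on, the start-up quantity controls the
  earlier ones, and injectivity of \<open>T\<^sub>\<delta>\<close> turns control of \<open>T\<^sub>\<delta> V\<close> into control of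
  \<open>V\<close>.
\<close>

lemma vanishes_if_energy_norm_sq_zero:
  assumes skew: "skew_operator Vs G" and "Vh \<subseteq> Vs"
    and e: "causal_nonneg Vh n0 N e" and d: "causal_nonneg Vh n0 N d"
    and V: "V \<in> seqs Vh N" and "0 \<le> \<tau>" and m: "m \<in> {n0..N}"
    and "0 < cE" and coercive: "\<forall>n\<in>{n0..N}. cE * (norm (Tstab G \<delta> (V n)))\<^sup>2 \<le> e n V"
    and zero: "startup G n0 \<delta> V + energy_norm_sq n0 \<tau> e d m V = 0"
    and "j \<le> m"
  shows "V j = 0"
proof -
  have E: "energy_norm_sq n0 \<tau> e d m V = 0" and I: "startup G n0 \<delta> V = 0"
    using zero startup_nonneg[of G n0 \<delta> V] energy_norm_sq_nonneg[OF e d V \<open>0 \<le> \<tau>\<close>, of m] m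
    by auto
  have "(norm (Tstab G \<delta> (V j)))\<^sup>2 \<le> 0"
  proof (cases "j < n0")
    case True
    then have "(norm (Tstab G \<delta> (V j)))\<^sup>2 \<le> startup G n0 \<delta> V"
      unfolding startup_def
      by (intro member_le_sum[of j "{..<n0}" "\<lambda>j. (norm (Tstab G \<delta> (V j)))\<^sup>2"]) auto
    then show ?thesis
      using I by simp
  next
    case False
    then have "cE * (norm (Tstab G \<delta> (V j)))\<^sup>2 \<le> e j V"
      using coercive \<open>j \<le> m\<close> m by auto
    also have "\<dots> \<le> energy_norm_sq n0 \<tau> e d m V"
      using False \<open>j \<le> m\<close> m by (intro energy_le_energy_norm_sq[OF d V \<open>0 \<le> \<tau>\<close>]) auto
    finally show ?thesis
      using E \<open>0 < cE\<close> by (simp add: mult_le_0_iff)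
  qed
  then have "Tstab G \<delta> (V j) = 0"
    by simp
  moreover have "V j \<in> Vs"
    using V \<open>Vh \<subseteq> Vs\<close> \<open>j \<le> m\<close> m by (auto simp: seqs_def)
  ultimately show ?thesis
    by (rule Tstab_eq_0D[OF skew, rotated])
qed

text \<open>
  The test sequence is \<open>V\<close> cut off after level \<open>m\<close>. The bound holds without any case distinction
  on the dual norm, since in the degenerate case both sides are zero, with the convention
  \<open>\<infinity> * 0 = 0\<close> of the extended reals.
\<close>

lemma pairing_le_dual_norm:
  assumes skew: "skew_operator Vs G" and "Vh \<subseteq> Vs" and "0 \<in> Vh"
    and e: "causal_nonneg Vh n0 N e" and d: "causal_nonneg Vh n0 N d"
    and V: "V \<in> seqs Vh N" and "0 \<le> \<tau>" and m: "m \<in> {n0..N}"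
    and "0 < cE" and coercive: "\<forall>n\<in>{n0..N}. cE * (norm (Tstab G \<delta> (V n)))\<^sup>2 \<le> e n V"
  shows "ereal (\<tau> * (\<Sum>n=n0..m. R n \<bullet> Pop G b l \<tau> \<delta> V n))
         \<le> dual_norm G b l n0 \<tau> \<delta> Vh N e d R
           * ereal (sqrt (startup G n0 \<delta> V + energy_norm_sq n0 \<tau> e d m V))"
    (is "ereal ?p \<le> ?D * ereal (sqrt ?X)")
proof (cases "?X = 0")
  case True
  have V0: "V j = 0" if "j \<le> m" for j
    using vanishes_if_energy_norm_sq_zero[OF skew \<open>Vh \<subseteq> Vs\<close> e d V \<open>0 \<le> \<tau>\<close> m \<open>0 < cE\<close>
        coercive True that] .
  have T0: "Tstab G \<delta> 0 = 0"
    using Tstab_zero[OF skew] \<open>Vh \<subseteq> Vs\<close> \<open>0 \<in> Vh\<close> by blast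
  have "Pop G b l \<tau> \<delta> V n = 0" if "n \<le> m" for n
    using V0 that by (simp add: Pop_def Sstab_def Mavg_def Dminus_def T0)
  then have "(\<Sum>n=n0..m. R n \<bullet> Pop G b l \<tau> \<delta> V n) = 0"
    by (intro sum.neutral) auto
  then show ?thesis
    using True by (simp flip: zero_ereal_def)
next
  case False
  have "0 \<le> ?X"
    using startup_nonneg[of G n0 \<delta> V] energy_norm_sq_nonneg[OF e d V \<open>0 \<le> \<tau>\<close>, of m] m by auto
  with False have X: "0 < ?X"
    by simp
  define W where "W = (\<lambda>n. if n \<le> m then V n else 0)"
  have W: "W \<in> seqs Vh N"
    using V \<open>0 \<in> Vh\<close> by (auto simp: W_def seqs_def)
  have VW: "W j = V j" if "j \<le> m" for j
    using that by (simp add: W_def)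
  have "startup G n0 \<delta> W = startup G n0 \<delta> V"
    using VW m by (intro startup_cong) auto
  moreover have "energy_norm_sq n0 \<tau> e d m W = energy_norm_sq n0 \<tau> e d m V"
    using VW m by (intro energy_norm_sq_cong[OF e d W V]) auto
  ultimately have XW: "startup G n0 \<delta> W + energy_norm_sq n0 \<tau> e d m W = ?X"
    by simp
  have "(\<Sum>n=n0..m. R n \<bullet> Pop G b l \<tau> \<delta> W n) = (\<Sum>n=n0..m. R n \<bullet> Pop G b l \<tau> \<delta> V n)"
  proof (rule sum.cong[OF refl])
    fix n assume "n \<in> {n0..m}"
    then have "Pop G b l \<tau> \<delta> W n = Pop G b l \<tau> \<delta> V n"
      using VW by (intro Pop_cong) auto
    then show "R n \<bullet> Pop G b l \<tau> \<delta> W n = R n \<bullet> Pop G b l \<tau> \<delta> V n"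
      by simp
  qed
  then have "?p / sqrt ?X = \<tau> * (\<Sum>n=n0..m. R n \<bullet> Pop G b l \<tau> \<delta> W n)
      / sqrt (startup G n0 \<delta> W + energy_norm_sq n0 \<tau> e d m W)"
    using XW by simp
  moreover have "\<forall>n. n \<notin> {0..m} \<longrightarrow> W n = 0"
    by (simp add: W_def)
  moreover have "startup G n0 \<delta> W + energy_norm_sq n0 \<tau> e d m W > 0"
    using X XW by simp
  ultimately have "?p / sqrt ?X \<in> dual_quotients G b l n0 \<tau> \<delta> Vh N e d R m"
    unfolding dual_quotients_def using W by blast
  then have "ereal (?p / sqrt ?X) \<le> ?D"
    using m by (rule dual_quotient_le_dual_norm)
  then have "ereal (?p / sqrt ?X) * ereal (sqrt ?X) \<le> ?D * ereal (sqrt ?X)"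
    using X by (intro ereal_mult_right_mono) auto
  then show ?thesis
    using X by simp
qed

section \<open>Absorption and the stability estimate\<close>

text \<open>
  Young's inequality in the form \<open>2 c r s \<le> s\<^sup>2 / 2 + 2 c\<^sup>2 r\<^sup>2\<close> with \<open>s = sqrt (I + X)\<close>
  leaves half of \<open>X\<close> on the left.
\<close>

lemma absorb_sqrt:
  fixes X I L r c :: real
  assumes "0 \<le> I + X" and "X \<le> 2 * c * (I + r * sqrt (I + X) + L)"
  shows "X \<le> (4 * c + 1) * I + 4 * c\<^sup>2 * r\<^sup>2 + 4 * c * L"
proof -
  define s where "s = sqrt (I + X)"
  have s: "s\<^sup>2 = I + X"
    using assms(1) by (simp add: s_def)
  have "0 \<le> (s - 2 * c * r)\<^sup>2"
    by simp
  then have "4 * c * (r * s) \<le> s\<^sup>2 + 4 * c\<^sup>2 * r\<^sup>2"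
    by (simp add: power2_eq_square algebra_simps)
  moreover have "X \<le> 2 * c * I + 2 * c * (r * s) + 2 * c * L"
    using assms(2) by (simp add: s_def algebra_simps)
  ultimately show ?thesis
    using s by (simp add: algebra_simps)
qed

text \<open>
  A bound that is uniform in the horizon controls the maximum of the energies and the total
  dissipation separately; this accounts for the factor 2.
\<close>

lemma energy_norm_sq_le_twice:
  assumes e: "causal_nonneg Vh n0 N e" and d: "causal_nonneg Vh n0 N d"
    and V: "V \<in> seqs Vh N" and "0 \<le> \<tau>" and "n0 \<le> N"
    and bound: "\<And>m. m \<in> {n0..N} \<Longrightarrow> e m V + \<tau> * (\<Sum>n=n0..m. d n V) \<le> B"
  shows "energy_norm_sq n0 \<tau> e d N V \<le> 2 * B"
proof -
  have "e m V \<le> B" if "m \<in> {n0..N}" for m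
    using bound[OF that] dissipation_nonneg[OF d V \<open>0 \<le> \<tau>\<close>, of m] that by auto
  then have "Max ((\<lambda>j. e j V) ` {n0..N}) \<le> B"
    using \<open>n0 \<le> N\<close> by (intro Max.boundedI) auto
  moreover have "0 \<le> e N V"
    using \<open>n0 \<le> N\<close> by (intro causal_nonnegD[OF e V]) auto
  then have "\<tau> * (\<Sum>n=n0..N. d n V) \<le> B"
    using bound[of N] \<open>n0 \<le> N\<close> by simp
  ultimately show ?thesis
    by (simp add: energy_norm_sq_def)
qed

text \<open>
  The stability estimate when the dual norm is a real number \<open>r\<close>. Its sign is not prescribed,
  hence the absolute value in the proof.
\<close>

lemma stability_finite_dual_norm:
  assumes skew: "skew_operator Vs G" and "Vh \<subseteq> Vs" and "0 \<in> Vh"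
    and e: "causal_nonneg Vh n0 N e" and d: "causal_nonneg Vh n0 N d"
    and "0 < \<tau>" and "n0 \<le> N" and "0 < cE" and "0 < CE"
    and EH: "energy_hypothesis G b l n0 \<tau> \<delta> Vh N e d cE CE"
    and sol: "discrete_solution G b l n0 \<tau> \<delta> Vh N R V"
    and D: "dual_norm G b l n0 \<tau> \<delta> Vh N e d R = ereal r"
  shows "energy_norm_sq n0 \<tau> e d N V
         \<le> (4 * CE + 1) * startup G n0 \<delta> V + 4 * CE\<^sup>2 * r\<^sup>2
           + 4 * CE * (\<tau> * l2_norm_sq n0 \<tau> N R)"
proof -
  define I where "I = startup G n0 \<delta> V"
  define X where "X = (\<lambda>m. energy_norm_sq n0 \<tau> e d m V)"
  define L where "L = \<tau> * l2_norm_sq n0 \<tau> N R"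
  have V: "V \<in> seqs Vh N"
    using sol by (simp add: discrete_solution_def)
  have coercive: "\<forall>n\<in>{n0..N}. cE * (norm (Tstab G \<delta> (V n)))\<^sup>2 \<le> e n V"
    using EH V by (simp add: energy_hypothesis_def)
  have bound: "e m V + \<tau> * (\<Sum>n=n0..m. d n V) \<le> CE * (I + \<bar>r\<bar> * sqrt (I + X N) + L)"
    if m: "m \<in> {n0..N}" for m
  proof -
    let ?p = "\<tau> * (\<Sum>n=n0..m. R n \<bullet> Pop G b l \<tau> \<delta> V n)"
    have "ereal ?p \<le> ereal r * ereal (sqrt (I + X m))"
      using pairing_le_dual_norm[OF skew \<open>Vh \<subseteq> Vs\<close> \<open>0 \<in> Vh\<close> e d V _ m \<open>0 < cE\<close> coercive]
        \<open>0 < \<tau>\<close> unfolding D[symmetric] I_def X_def by simp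
    then have "?p \<le> r * sqrt (I + X m)"
      by simp
    also have "\<dots> \<le> \<bar>r\<bar> * sqrt (I + X N)"
    proof (rule mult_mono)
      show "sqrt (I + X m) \<le> sqrt (I + X N)"
        using energy_norm_sq_mono[OF d V, of \<tau> m e] \<open>0 < \<tau>\<close> m by (simp add: X_def)
      show "0 \<le> sqrt (I + X m)"
        using energy_norm_sq_nonneg[OF e d V, of \<tau> m] startup_nonneg[of G n0 \<delta> V] \<open>0 < \<tau>\<close> m
        by (simp add: I_def X_def)
    qed auto
    finally have p: "?p \<le> \<bar>r\<bar> * sqrt (I + X N)" .
    have L: "\<tau> * l2_norm_sq n0 \<tau> m R \<le> L"
      using l2_norm_sq_mono[of \<tau> m N n0 R] \<open>0 < \<tau>\<close> m by (simp add: L_def)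
    have "e m V + \<tau> * (\<Sum>n=n0..m. d n V)
        \<le> CE * I + CE * \<tau> * (\<Sum>n=n0..m. R n \<bullet> Pop G b l \<tau> \<delta> V n)
          + CE * \<tau> * l2_norm_sq n0 \<tau> m R"
      using EH sol m unfolding energy_hypothesis_def I_def by blast
    also have "\<dots> = CE * (I + ?p + \<tau> * l2_norm_sq n0 \<tau> m R)"
      by (simp add: algebra_simps)
    also have "\<dots> \<le> CE * (I + \<bar>r\<bar> * sqrt (I + X N) + L)"
      using p L \<open>0 < CE\<close> by (intro mult_left_mono add_mono) auto
    finally show ?thesis .
  qed
  have "X N \<le> 2 * (CE * (I + \<bar>r\<bar> * sqrt (I + X N) + L))"
    unfolding X_def using \<open>0 < \<tau>\<close> \<open>n0 \<le> N\<close> bound[unfolded X_def]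
    by (intro energy_norm_sq_le_twice[OF e d V]) auto
  then have "X N \<le> 2 * CE * (I + \<bar>r\<bar> * sqrt (I + X N) + L)"
    by (simp add: mult.assoc)
  moreover have "0 \<le> I + X N"
    using energy_norm_sq_nonneg[OF e d V, of \<tau> N] startup_nonneg[of G n0 \<delta> V] \<open>0 < \<tau>\<close> \<open>n0 \<le> N\<close>
    by (simp add: I_def X_def)
  ultimately have "X N \<le> (4 * CE + 1) * I + 4 * CE\<^sup>2 * \<bar>r\<bar>\<^sup>2 + 4 * CE * L"
    by (intro absorb_sqrt)
  then show ?thesis
    by (simp add: I_def X_def L_def)
qed

text \<open>
  What remains is to merge the three constants into one and to observe that an infinite dual norm,
  of either sign, has an infinite square and so makes the right-hand side infinite.
\<close>

theorem theorem3p1: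
  fixes Vs :: "'a::{real_inner, banach} set"
    and G :: "'a \<Rightarrow> 'a"
    and Vh :: "real \<Rightarrow> 'a set"
    and b :: "nat \<Rightarrow> real"
    and l n0 :: nat
    and T cE CE :: real
  assumes "subspace Vs" and "closure Vs = UNIV"
    and "skew_operator Vs G"
    and "l \<le> n0" and "1 \<le> n0"
    and "0 < cE" and "0 < CE"
  shows "\<exists>C>0. \<forall>h>0. \<forall>\<tau>>0. \<forall>\<delta>>0. \<forall>N e d R V.
           finite_dim_subspace (Vh h) \<longrightarrow> Vh h \<subseteq> Vs \<longrightarrow>
           n0 \<le> N \<longrightarrow> real N * \<tau> \<le> T \<longrightarrow>
           causal_nonneg (Vh h) n0 N e \<longrightarrow> causal_nonneg (Vh h) n0 N d \<longrightarrow>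
           energy_hypothesis G b l n0 \<tau> \<delta> (Vh h) N e d cE CE \<longrightarrow>
           discrete_solution G b l n0 \<tau> \<delta> (Vh h) N R V \<longrightarrow>
           ereal (energy_norm_sq n0 \<tau> e d N V)
           \<le> ereal C * (ereal (startup G n0 \<delta> V)
                        + (dual_norm G b l n0 \<tau> \<delta> (Vh h) N e d R)\<^sup>2
                        + ereal (\<tau> * l2_norm_sq n0 \<tau> N R))"
proof (intro exI[of _ "4 * CE\<^sup>2 + 4 * CE + 1"] conjI allI impI)
  show "0 < 4 * CE\<^sup>2 + 4 * CE + 1"
    using \<open>0 < CE\<close> by (simp add: add_pos_pos)
next
  fix h \<tau> \<delta> :: real and N :: nat and e d :: "nat \<Rightarrow> (nat \<Rightarrow> 'a) \<Rightarrow> real" and R V :: "nat \<Rightarrow> 'a"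
  assume "0 < h" and "0 < \<tau>" and "0 < \<delta>"
    and sub: "finite_dim_subspace (Vh h)" "Vh h \<subseteq> Vs" and N: "n0 \<le> N" "real N * \<tau> \<le> T"
    and e: "causal_nonneg (Vh h) n0 N e" and d: "causal_nonneg (Vh h) n0 N d"
    and EH: "energy_hypothesis G b l n0 \<tau> \<delta> (Vh h) N e d cE CE"
    and sol: "discrete_solution G b l n0 \<tau> \<delta> (Vh h) N R V"
  let ?C = "4 * CE\<^sup>2 + 4 * CE + 1"
  let ?I = "startup G n0 \<delta> V" and ?L = "\<tau> * l2_norm_sq n0 \<tau> N R"
    and ?D = "dual_norm G b l n0 \<tau> \<delta> (Vh h) N e d R"
  have "0 \<in> Vh h"
    using sub(1) by (simp add: finite_dim_subspace_def subspace_0)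
  have I: "0 \<le> ?I"
    by (rule startup_nonneg)
  have L: "0 \<le> ?L"
    using l2_norm_sq_nonneg[of \<tau> n0 N R] \<open>0 < \<tau>\<close> by simp
  have C: "0 < ?C"
    using \<open>0 < CE\<close> by (simp add: add_pos_pos)
  show "ereal (energy_norm_sq n0 \<tau> e d N V) \<le> ereal ?C * (ereal ?I + ?D\<^sup>2 + ereal ?L)"
  proof (cases "\<bar>?D\<bar> = \<infinity>")
    case True
    then have "?D\<^sup>2 = \<infinity>"
      by (cases ?D) (auto simp: power2_eq_square)
    then show ?thesis
      using C by simp
  next
    case False
    then obtain r where r: "?D = ereal r"
      by (cases ?D) auto
    have "energy_norm_sq n0 \<tau> e d N V
        \<le> (4 * CE + 1) * ?I + 4 * CE\<^sup>2 * r\<^sup>2 + 4 * CE * ?L"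
      by (rule stability_finite_dual_norm[OF \<open>skew_operator Vs G\<close> sub(2) \<open>0 \<in> Vh h\<close> e d
            \<open>0 < \<tau>\<close> N(1) \<open>0 < cE\<close> \<open>0 < CE\<close> EH sol r])
    also have "\<dots> \<le> ?C * ?I + ?C * r\<^sup>2 + ?C * ?L"
      using I L \<open>0 < CE\<close> by (intro add_mono mult_right_mono) auto
    also have "\<dots> = ?C * (?I + r\<^sup>2 + ?L)"
      by (simp add: distrib_left)
    finally show ?thesis
      using r by simp
  qed
qed

end
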